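(* Let $s \ge 2$ and $d \ge 1$. Up to similarity (isometry and scaling), there are only finitely many $s$-distance sets $X$ in $\mathbb{R}^d$ with $|X| \ge 2\binom{d+s-1}{s-1} + 2\binom{d+s-2}{s-2}$.
   Context: A finite set $X \subset \mathbb{R}^d$ is called an $s$-distance set if $|A(X)| = s$, where $A(X) = \{ d(x,y) : x, y \in X, x \neq y\}$ and $d(x,y)$ is the Euclidean distance. *)

theory Defs
  imports "HOL-Analysis.Analysis"
begin

definition dist_set :: "'a::metric_space set \<Rightarrow> real set" where
  "dist_set X = {dist x y | x y. x \<in> X \<and> y \<in> X \<and> x \<noteq> y}"

definition s_distance_set :: "nat \<Rightarrow> 'a::metric_space set \<Rightarrow> bool" where
  "s_distance_set s X \<longleftrightarrow> finite X \<and> card (dist_set X) = s"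

definition similarity_map :: "('a::metric_space \<Rightarrow> 'a) \<Rightarrow> bool" where
  "similarity_map f \<longleftrightarrow> (\<exists>c>0. \<forall>x y. dist (f x) (f y) = c * dist x y)"

definition similar_sets :: "'a::metric_space set \<Rightarrow> 'a set \<Rightarrow> bool" where
  "similar_sets X Y \<longleftrightarrow> (\<exists>f. similarity_map f \<and> f ` Y = X)"

end

(* Large s-distance sets carry a nonzero function v annihilating every polynomial of degree below s
   in the squared distance |x - y|^2, since these span a space of dimension at most
   N = C(d+s-1,s-1) + C(d+s-2,s-2) < |X|. The Lagrange polynomials at the squared distances a_i turn v
   into a common eigenvector of the 0/1 distance graphs, with eigenvalues -K_i where
   K_i = prod_{j /= i} a_j / (a_j - a_i). As |X| is bounded, only finitely many vectors K occur;
   unlike in the Larman-Rogers-Seidel theorem, the integrality of the K_i is not needed.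
   For a given K the normalised squared distances satisfy sum_i K_i p(a_i) = p(0) for deg p < s. The set of
   such a is compact, because Rolle's theorem forbids nodes from merging or tending to 0, and discrete,
   because the Jacobian is a Vandermonde matrix; hence it is finite. So the distance matrices, up to
   scaling, are finite in number, and they determine X up to similarity. *)

theory Submission
  imports Defs
begin

section \<open>Linear systems and eigenvalues\<close>

text \<open>Gaussian elimination: each induction step removes one equation and at most one unknown,
  so the unknowns stay in excess.\<close>

lemma exists_annihilator:
  fixes f :: "'i \<Rightarrow> 'a \<Rightarrow> real"
  assumes "finite I" "finite X" "card I < card X"
  shows "\<exists>v. (\<exists>x\<in>X. v x \<noteq> 0) \<and> (\<forall>i\<in>I. (\<Sum>x\<in>X. v x * f i x) = 0)"
  using assms
proof (induction I arbitrary: X f rule: finite_induct)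
  case empty
  then show ?case by (intro exI[of _ "\<lambda>_. 1"]) (auto simp: card_gt_0_iff)
next
  case (insert i I)
  show ?case
  proof (cases "\<forall>x\<in>X. f i x = 0")
    case True
    with insert show ?thesis by fastforce
  next
    case False
    then obtain z where z: "z \<in> X" "f i z \<noteq> 0" by auto
    \<comment> \<open>A row operation chosen so that \<open>g j z = 0\<close>: the unknown at the
      pivot z drops out of the other equations.\<close>
    define g where "g j x = f j x - f j z / f i z * f i x" for j x
    have "card I < card (X - {z})" using insert z by simp
    then obtain v where v: "\<exists>x\<in>X - {z}. v x \<noteq> 0" "\<forall>j\<in>I. (\<Sum>x\<in>X - {z}. v x * g j x) = 0"
      using insert.IH[of "X - {z}" g] insert.prems by auto
    \<comment> \<open>The value at z is forced by equation i.\<close>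
    define w where "w = v(z := - (\<Sum>x\<in>X - {z}. v x * f i x) / f i z)"
    have sum_w: "(\<Sum>x\<in>X. w x * h x) = w z * h z + (\<Sum>x\<in>X - {z}. v x * h x)" for h
      using insert.prems z by (simp add: sum.remove[of X z] w_def)
    have "(\<Sum>x\<in>X. w x * f j x) = 0" if "j \<in> insert i I" for j
    proof (cases "j = i")
      case True
      then show ?thesis using z by (simp add: sum_w, simp add: w_def)
    next
      case False
      then have "(\<Sum>x\<in>X - {z}. v x * g j x) = 0" using that v by auto
      then have "(\<Sum>x\<in>X - {z}. v x * f j x) = f j z / f i z * (\<Sum>x\<in>X - {z}. v x * f i x)"
        by (simp add: g_def algebra_simps sum_subtractf sum_distrib_left)
      then show ?thesis by (simp add: sum_w, simp add: w_def)
    qed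
    moreover have "\<exists>x\<in>X. w x \<noteq> 0" using v(1) by (auto simp: w_def)
    ultimately show ?thesis by blast
  qed
qed

text \<open>Eigenvectors for distinct eigenvalues are orthogonal by symmetry, while
  \<open>card X + 1\<close> of them would be linearly dependent by
  \<open>exists_annihilator\<close>.\<close>

lemma finite_symmetric_eigenvalues:
  fixes A :: "'a \<Rightarrow> 'a \<Rightarrow> real"
  assumes "finite X" and sym: "\<And>x y. x \<in> X \<Longrightarrow> y \<in> X \<Longrightarrow> A x y = A y x"
  shows "finite {k. \<exists>v. (\<exists>x\<in>X. v x \<noteq> 0) \<and> (\<forall>x\<in>X. (\<Sum>y\<in>X. A x y * v y) = k * v x)}"
    (is "finite ?E")
proof (rule ccontr)
  assume "infinite ?E"
  then obtain J where J: "J \<subseteq> ?E" "finite J" "card J = Suc (card X)"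
    using infinite_arbitrarily_large by blast
  have "\<forall>k\<in>J. \<exists>v. (\<exists>x\<in>X. v x \<noteq> 0) \<and> (\<forall>x\<in>X. (\<Sum>y\<in>X. A x y * v y) = k * v x)"
    using J by auto
  then obtain v where v: "\<And>k. k \<in> J \<Longrightarrow> \<exists>x\<in>X. v k x \<noteq> 0"
      "\<And>k x. k \<in> J \<Longrightarrow> x \<in> X \<Longrightarrow> (\<Sum>y\<in>X. A x y * v k y) = k * v k x"
    by metis
  have orth: "(\<Sum>x\<in>X. v k x * v l x) = 0" if "k \<in> J" "l \<in> J" "k \<noteq> l" for k l
  proof -
    have "k * (\<Sum>x\<in>X. v k x * v l x) = (\<Sum>x\<in>X. (\<Sum>y\<in>X. A x y * v k y) * v l x)"
      using v(2) that by (simp add: sum_distrib_left algebra_simps)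
    also have "\<dots> = (\<Sum>x\<in>X. \<Sum>y\<in>X. A x y * v k y * v l x)"
      by (simp add: sum_distrib_right)
    also have "\<dots> = (\<Sum>y\<in>X. \<Sum>x\<in>X. A x y * v k y * v l x)" by (rule sum.swap)
    also have "\<dots> = (\<Sum>y\<in>X. v k y * (\<Sum>x\<in>X. A y x * v l x))"
      using sym by (auto simp: sum_distrib_left algebra_simps intro!: sum.cong)
    also have "\<dots> = l * (\<Sum>x\<in>X. v k x * v l x)"
      using v(2) that by (simp add: sum_distrib_left algebra_simps)
    finally show ?thesis using that by simp
  qed
  \<comment> \<open>The roles are swapped: points of X index the equations, eigenvalues in J index
    the unknowns.\<close>
  obtain c where c: "\<exists>k\<in>J. c k \<noteq> 0" "\<forall>x\<in>X. (\<Sum>k\<in>J. c k * v k x) = 0"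
    using exists_annihilator[of X J "\<lambda>x k. v k x"] J assms by auto
  then obtain l where l: "l \<in> J" "c l \<noteq> 0" by blast
  have "0 = (\<Sum>x\<in>X. (\<Sum>k\<in>J. c k * v k x) * v l x)" using c by simp
  also have "\<dots> = (\<Sum>x\<in>X. \<Sum>k\<in>J. c k * v k x * v l x)"
    by (simp add: sum_distrib_right)
  also have "\<dots> = (\<Sum>k\<in>J. \<Sum>x\<in>X. c k * v k x * v l x)" by (rule sum.swap)
  also have "\<dots> = (\<Sum>k\<in>J. c k * (\<Sum>x\<in>X. v k x * v l x))"
    by (simp add: sum_distrib_left mult.assoc)
  also have "\<dots> = (\<Sum>k\<in>J. if k = l then c l * (\<Sum>x\<in>X. v l x * v l x) else 0)"
    using orth l by (intro sum.cong) auto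
  also have "\<dots> = c l * (\<Sum>x\<in>X. v l x * v l x)" using J l by simp
  finally have "(\<Sum>x\<in>X. v l x * v l x) = 0" using l by simp
  then have "\<forall>x\<in>X. v l x = 0" using assms(1) by (subst (asm) sum_nonneg_eq_0_iff) auto
  with v(1) l show False by blast
qed

section \<open>Polynomials on the paraboloid\<close>

inductive_set function_span :: "('a \<Rightarrow> real) set \<Rightarrow> ('a \<Rightarrow> real) set" for B where
  zero: "(\<lambda>_. 0) \<in> function_span B"
| step: "b \<in> B \<Longrightarrow> f \<in> function_span B \<Longrightarrow> (\<lambda>x. c * b x + f x) \<in> function_span B"

lemma function_span_add:
  assumes "f \<in> function_span B" "g \<in> function_span B"
  shows "(\<lambda>x. f x + g x) \<in> function_span B"
  using assms(1)
proof induction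
  case zero
  then show ?case using assms(2) by simp
next
  case (step b f c)
  then show ?case using function_span.step[of b B "\<lambda>x. f x + g x" c] by (simp add: add.assoc)
qed

lemma function_span_scale:
  assumes "f \<in> function_span B"
  shows "(\<lambda>x. c * f x) \<in> function_span B"
  using assms
proof induction
  case zero
  then show ?case using function_span.zero by simp
next
  case (step b f c')
  then show ?case
    using function_span.step[of b B "\<lambda>x. c * f x" "c * c'"] by (simp add: algebra_simps)
qed

lemma function_span_base: "b \<in> B \<Longrightarrow> b \<in> function_span B"
  using function_span.step[of b B "\<lambda>_. 0" 1] function_span.zero[of B] by simp

lemma function_span_sum:
  assumes "\<And>i. i \<in> I \<Longrightarrow> f i \<in> function_span B"
  shows "(\<lambda>x. \<Sum>i\<in>I. f i x) \<in> function_span B"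
proof (cases "finite I")
  case True
  then show ?thesis using assms
    by (induction I) (auto intro: function_span.zero function_span_add)
qed (simp add: function_span.zero)

text \<open>Multiplication by w is linear, so it is enough to control it on generators. With B and C
  consecutive degree levels this raises the degree by one.\<close>

lemma function_span_mult:
  assumes "f \<in> function_span B" and "\<And>b. b \<in> B \<Longrightarrow> (\<lambda>x. w x * b x) \<in> function_span C"
  shows "(\<lambda>x. w x * f x) \<in> function_span C"
  using assms(1)
proof induction
  case zero
  then show ?case using function_span.zero by simp
next
  case (step b f c)
  then have "(\<lambda>x. c * (w x * b x) + w x * f x) \<in> function_span C"
    using function_span_add[OF function_span_scale[OF assms(2)[OF step(1)]] step.IH] by blast
  then show ?case by (simp add: algebra_simps)
qed

lemma function_span_mono:
  assumes "f \<in> function_span B" "B \<subseteq> C"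
  shows "f \<in> function_span C"
  using assms(1)
proof induction
  case (step b f c)
  then show ?case using assms(2) by (intro function_span.step) auto
qed (rule function_span.zero)

lemma function_span_annihilated:
  assumes "f \<in> function_span B" "\<And>b. b \<in> B \<Longrightarrow> (\<Sum>x\<in>X. v x * b x) = 0"
  shows "(\<Sum>x\<in>X. v x * f x) = 0"
  using assms(1)
proof induction
  case (step b f c)
  have "(\<Sum>x\<in>X. v x * (c * b x + f x)) = c * (\<Sum>x\<in>X. v x * b x) + (\<Sum>x\<in>X. v x * f x)"
    by (simp add: algebra_simps sum.distrib sum_distrib_left)
  also have "\<dots> = 0" unfolding assms(2)[OF step(1)] step.IH by simp
  finally show ?case .
qed simp

section \<open>Monomials of bounded degree in a list of functions\<close>

text \<open>The products of at most k factors from the list, repetition allowed. Splitting off one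
  copy of the head mirrors Pascal's rule.\<close>

fun monomials :: "('a \<Rightarrow> real) list \<Rightarrow> nat \<Rightarrow> ('a \<Rightarrow> real) set" where
  "monomials [] k = {\<lambda>_. 1}"
| "monomials (w # ws) 0 = {\<lambda>_. 1}"
| "monomials (w # ws) (Suc k) = monomials ws (Suc k) \<union> (\<lambda>f x. w x * f x) ` monomials (w # ws) k"

text \<open>Pascal's rule along the recursion. It is an inequality because different products may
  agree as functions.\<close>

lemma card_monomials:
  "finite (monomials ws k) \<and> card (monomials ws k) \<le> (length ws + k) choose k"
proof (induction ws k rule: monomials.induct)
  case (3 w ws k)
  have "card (monomials (w # ws) (Suc k))
      \<le> card (monomials ws (Suc k)) + card ((\<lambda>f x. w x * f x) ` monomials (w # ws) k)"
    unfolding monomials.simps by (rule card_Un_le)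
  also have "\<dots> \<le> card (monomials ws (Suc k)) + card (monomials (w # ws) k)"
    using 3 by (intro add_left_mono card_image_le) blast
  also have "\<dots> \<le> (length ws + Suc k choose Suc k) + (length (w # ws) + k choose k)"
    using 3 by (intro add_mono) blast+
  finally have "card (monomials (w # ws) (Suc k)) \<le> (length (w # ws) + Suc k choose Suc k)"
    by (simp del: monomials.simps)
  moreover have "finite (monomials (w # ws) (Suc k))"
    unfolding monomials.simps using 3 by blast
  ultimately show ?case by blast
qed auto

lemma one_in_monomials: "(\<lambda>_. 1) \<in> monomials ws k"
  by (induction ws k rule: monomials.induct) auto

lemma monomials_Suc: "monomials ws k \<subseteq> monomials ws (Suc k)"
proof (induction ws k rule: monomials.induct)
  case (3 w ws k)
  have "monomials (w # ws) (Suc k) = monomials ws (Suc k) \<union> (\<lambda>f x. w x * f x) ` monomials (w # ws) k"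
    by (rule monomials.simps)
  also have "\<dots> \<subseteq> monomials ws (Suc (Suc k)) \<union> (\<lambda>f x. w x * f x) ` monomials (w # ws) (Suc k)"
    using 3 by (intro Un_mono image_mono)
  also have "\<dots> = monomials (w # ws) (Suc (Suc k))"
    by (rule monomials.simps(3)[symmetric])
  finally show ?case .
qed (use one_in_monomials in auto)

lemma head_mult_monomials:
  "f \<in> monomials (w # ws) k \<Longrightarrow> (\<lambda>x. w x * f x) \<in> monomials (w # ws) (Suc k)"
  by (subst monomials.simps(3)) (intro UnI2 imageI)

lemma generator_in_monomials: "w \<in> set ws \<Longrightarrow> w \<in> monomials ws (Suc 0)"
proof (induction ws)
  case (Cons u ws)
  have "u = (\<lambda>x. u x * 1)" by simp
  with Cons show ?case by auto
qed simp

lemma monomials_mult: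
  "w \<in> set ws \<Longrightarrow> f \<in> monomials ws k \<Longrightarrow> (\<lambda>x. w x * f x) \<in> monomials ws (Suc k)"
proof (induction ws k arbitrary: f rule: monomials.induct)
  case (2 u ws)
  then show ?case using generator_in_monomials[of w "u # ws"] by simp
next
  case (3 u ws k)
  show ?case
  proof (cases "w = u")
    case True
    then show ?thesis using head_mult_monomials 3(4) by metis
  next
    case False
    then have w: "w \<in> set ws" using 3(3) by simp
    from 3(4) consider "f \<in> monomials ws (Suc k)"
      | g where "g \<in> monomials (u # ws) k" "f = (\<lambda>x. u x * g x)"
      by auto
    then show ?thesis
    proof cases
      case 1
      then show ?thesis using 3(1)[OF w] by (subst monomials.simps(3)) (rule UnI1)
    next
      case 2
      then have "(\<lambda>x. w x * g x) \<in> monomials (u # ws) (Suc k)" using 3(2)[OF 3(3)] by simp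
      then have "(\<lambda>x. u x * (w x * g x)) \<in> monomials (u # ws) (Suc (Suc k))"
        by (rule head_mult_monomials)
      moreover have "(\<lambda>x. w x * f x) = (\<lambda>x. u x * (w x * g x))" using 2 by (auto simp: algebra_simps)
      ultimately show ?thesis by metis
    qed
  qed
qed simp

section \<open>Spanning functions on the paraboloid and the annihilator\<close>

text \<open>In use L lists all coordinates but one, so together with the squared norm there are
  exactly \<open>CARD('n)\<close> generators, and the squared norm counts as degree one.\<close>

definition paraboloid_gens :: "'n list \<Rightarrow> (real ^ 'n::finite \<Rightarrow> real) list" where
  "paraboloid_gens L = (\<lambda>y. y \<bullet> y) # map (\<lambda>i y. y $ i) L"

text \<open>On the paraboloid \<open>z = \<bar>y\<bar>\<^sup>2\<close> the square of the coordinate \<open>i\<close> equals \<open>z\<close> minus the other squares,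
  so degree at most one in that coordinate suffices. This is what makes the dimension count sharp enough.\<close>

definition paraboloid_basis :: "'n \<Rightarrow> 'n list \<Rightarrow> nat \<Rightarrow> (real ^ 'n::finite \<Rightarrow> real) set" where
  "paraboloid_basis i L k = monomials (paraboloid_gens L) k \<union>
     (if k = 0 then {} else (\<lambda>f y. y $ i * f y) ` monomials (paraboloid_gens L) (k - 1))"

text \<open>For s = k + 2 and d = \<open>CARD('n)\<close> the bound reads C(d+s-1,s-1) +
  C(d+s-2,s-2), half of the threshold in the theorem.\<close>

lemma card_paraboloid_basis:
  fixes i :: "'n::finite"
  assumes "Suc (length L) = CARD('n)"
  shows "finite (paraboloid_basis i L (Suc k))"
    and "card (paraboloid_basis i L (Suc k)) \<le> (CARD('n) + Suc k choose Suc k) + (CARD('n) + k choose k)"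
proof -
  let ?M = "monomials (paraboloid_gens L :: (real ^ 'n \<Rightarrow> real) list)"
  have len: "length (paraboloid_gens L :: (real ^ 'n \<Rightarrow> real) list) = CARD('n)"
    using assms by (simp add: paraboloid_gens_def)
  show "finite (paraboloid_basis i L (Suc k))"
    using card_monomials[of "paraboloid_gens L"] by (simp add: paraboloid_basis_def)
  have "card (paraboloid_basis i L (Suc k)) \<le> card (?M (Suc k)) + card ((\<lambda>f y. y $ i * f y) ` ?M k)"
    unfolding paraboloid_basis_def using card_Un_le[of "?M (Suc k)" "(\<lambda>f y. y $ i * f y) ` ?M k"] by simp
  also have "\<dots> \<le> card (?M (Suc k)) + card (?M k)"
    using card_monomials by (intro add_left_mono card_image_le) blast
  also have "\<dots> \<le> (CARD('n) + Suc k choose Suc k) + (CARD('n) + k choose k)"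
    using card_monomials[of "paraboloid_gens L"] unfolding len by (intro add_mono) blast+
  finally show "card (paraboloid_basis i L (Suc k))
    \<le> (CARD('n) + Suc k choose Suc k) + (CARD('n) + k choose k)" .
qed

lemma paraboloid_basis_Suc: "paraboloid_basis i L k \<subseteq> paraboloid_basis i L (Suc k)"
proof -
  let ?M = "monomials (paraboloid_gens L)"
  have "?M (k - 1) \<subseteq> ?M k" if "k \<noteq> 0" using monomials_Suc[of _ "k - 1"] that by simp
  then show ?thesis using monomials_Suc[of "paraboloid_gens L" k]
    unfolding paraboloid_basis_def by (auto simp: image_iff)
qed

lemma paraboloid_gen_mult:
  assumes "w \<in> set (paraboloid_gens L)" "b \<in> paraboloid_basis i L k"
  shows "(\<lambda>y. w y * b y) \<in> paraboloid_basis i L (Suc k)"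
proof (cases "b \<in> monomials (paraboloid_gens L) k")
  case True
  then show ?thesis using monomials_mult[OF assms(1)] by (simp add: paraboloid_basis_def)
next
  case False
  then obtain f where f: "k \<noteq> 0" "f \<in> monomials (paraboloid_gens L) (k - 1)" "b = (\<lambda>y. y $ i * f y)"
    using assms(2) by (auto simp: paraboloid_basis_def split: if_splits)
  have "(\<lambda>y. w y * f y) \<in> monomials (paraboloid_gens L) k"
    using monomials_mult[OF assms(1) f(2)] f(1) by simp
  moreover have "(\<lambda>y. w y * b y) = (\<lambda>y. y $ i * (w y * f y))"
    using f by (auto simp: algebra_simps)
  ultimately show ?thesis by (auto simp: paraboloid_basis_def)
qed

text \<open>The only critical case is j = i with b = y_i f, where f has degree at most k - 1 in the
  generators. Then y_i^2 f is |y|^2 f minus the terms y_l^2 f with l different from i, and all of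
  these have degree at most k + 1.\<close>

lemma paraboloid_coord_mult:
  fixes i :: "'n::finite"
  assumes L: "distinct L" "set L = UNIV - {i}" and b: "b \<in> paraboloid_basis i L k"
  shows "(\<lambda>y. y $ j * b y) \<in> function_span (paraboloid_basis i L (Suc k))"
proof (cases "j = i")
  case False
  then have "(\<lambda>y. y $ j) \<in> set (paraboloid_gens L)" using L by (auto simp: paraboloid_gens_def)
  from paraboloid_gen_mult[OF this b] show ?thesis by (rule function_span_base)
next
  case True
  note j = this
  let ?M = "monomials (paraboloid_gens L :: (real ^ 'n \<Rightarrow> real) list)"
  show ?thesis
  proof (cases "b \<in> ?M k")
    case True
    then show ?thesis using j by (intro function_span_base) (simp add: paraboloid_basis_def)
  next
    case False
    then obtain f where f: "k \<noteq> 0" "f \<in> ?M (k - 1)" "b = (\<lambda>y. y $ i * f y)"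
      using b by (auto simp: paraboloid_basis_def split: if_splits)
    have g: "(\<lambda>y. w y * f y) \<in> ?M k" if "w \<in> set (paraboloid_gens L)" for w
      using monomials_mult[OF that f(2)] f(1) by simp
    have up: "g \<in> function_span (paraboloid_basis i L (Suc k))" if "g \<in> ?M (Suc k)" for g
      using that by (intro function_span_base) (simp add: paraboloid_basis_def)
    have z: "(\<lambda>y. y \<bullet> y) \<in> set (paraboloid_gens L)" by (simp add: paraboloid_gens_def)
    have c: "(\<lambda>y. y $ l) \<in> set (paraboloid_gens L)" if "l \<noteq> i" for l
      using that L by (auto simp: paraboloid_gens_def)
    have 1: "(\<lambda>y. (y \<bullet> y) * f y) \<in> function_span (paraboloid_basis i L (Suc k))"
      using g[OF z] monomials_Suc up by blast
    have 2: "(\<lambda>y. \<Sum>l\<in>UNIV - {i}. y $ l * (y $ l * f y)) \<in> function_span (paraboloid_basis i L (Suc k))"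
      by (intro function_span_sum up monomials_mult g c) auto
    have "(\<lambda>y. y $ j * b y) = (\<lambda>y. (y \<bullet> y) * f y + (-1) * (\<Sum>l\<in>UNIV - {i}. y $ l * (y $ l * f y)))"
    proof
      fix y :: "real ^ 'n"
      have "y \<bullet> y = y $ i * y $ i + (\<Sum>l\<in>UNIV - {i}. y $ l * y $ l)"
        by (simp add: inner_vec_def sum.remove[of UNIV i])
      moreover have "(\<Sum>l\<in>UNIV - {i}. y $ l * (y $ l * f y)) = (\<Sum>l\<in>UNIV - {i}. y $ l * y $ l) * f y"
        by (simp add: sum_distrib_right mult.assoc)
      ultimately show "y $ j * b y = (y \<bullet> y) * f y + (-1) * (\<Sum>l\<in>UNIV - {i}. y $ l * (y $ l * f y))"
        by (simp only: f j) (simp add: distrib_right)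
    qed
    then show ?thesis using function_span_add[OF 1 function_span_scale[OF 2, of "-1"]] by simp
  qed
qed

text \<open>Expand |x - y|^2 = |x|^2 + |y|^2 - 2 x.y: as a function of y, each term raises the
  degree by at most one, since |y|^2 is itself a generator.\<close>

lemma paraboloid_dist_mult:
  fixes i :: "'n::finite"
  assumes L: "distinct L" "set L = UNIV - {i}" and f: "f \<in> function_span (paraboloid_basis i L k)"
  shows "(\<lambda>y. (dist x y)\<^sup>2 * f y) \<in> function_span (paraboloid_basis i L (Suc k))"
proof (rule function_span_mult[OF f])
  fix b :: "real ^ 'n \<Rightarrow> real" assume b: "b \<in> paraboloid_basis i L k"
  let ?S = "function_span (paraboloid_basis i L (Suc k))"
  have 1: "(\<lambda>y. (x \<bullet> x) * b y) \<in> ?S"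
    using b paraboloid_basis_Suc by (intro function_span_scale function_span_base) blast
  have 2: "(\<lambda>y. (y \<bullet> y) * b y) \<in> ?S"
    using b by (intro function_span_base paraboloid_gen_mult) (simp add: paraboloid_gens_def)
  have 3: "(\<lambda>y. \<Sum>j\<in>UNIV. (- 2 * x $ j) * (y $ j * b y)) \<in> ?S"
    by (intro function_span_sum function_span_scale paraboloid_coord_mult[OF L b])
  have "(\<lambda>y. (dist x y)\<^sup>2 * b y)
      = (\<lambda>y. (x \<bullet> x) * b y + ((y \<bullet> y) * b y + (\<Sum>j\<in>UNIV. (- 2 * x $ j) * (y $ j * b y))))"
  proof
    fix y
    have "(dist x y)\<^sup>2 = x \<bullet> x + y \<bullet> y - 2 * (x \<bullet> y)"
      by (simp add: dist_norm power2_norm_eq_inner algebra_simps inner_commute)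
    also have "x \<bullet> y = (\<Sum>j\<in>UNIV. x $ j * y $ j)" by (simp add: inner_vec_def)
    finally have "(dist x y)\<^sup>2 = x \<bullet> x + y \<bullet> y - 2 * (\<Sum>j\<in>UNIV. x $ j * y $ j)" .
    moreover have "(\<Sum>j\<in>UNIV. (- 2 * x $ j) * (y $ j * b y)) = - 2 * (\<Sum>j\<in>UNIV. x $ j * y $ j) * b y"
      by (simp add: sum_distrib_left sum_distrib_right mult.assoc)
    ultimately show "(dist x y)\<^sup>2 * b y
      = (x \<bullet> x) * b y + ((y \<bullet> y) * b y + (\<Sum>j\<in>UNIV. (- 2 * x $ j) * (y $ j * b y)))"
      by (simp only:) (simp add: algebra_simps)
  qed
  then show "(\<lambda>y. (dist x y)\<^sup>2 * b y) \<in> ?S"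
    using function_span_add[OF 1 function_span_add[OF 2 3]] by simp
qed

text \<open>One v serves all centres x, because the powers of the squared distance up to
  \<open>Suc m\<close> lie in a single span that does not depend on x and has fewer than
  \<open>card X\<close> spanning functions.\<close>

lemma exists_distance_annihilator:
  fixes X :: "(real ^ 'n::finite) set"
  assumes "finite X" and card: "(CARD('n) + Suc m choose Suc m) + (CARD('n) + m choose m) < card X"
  shows "\<exists>v. (\<exists>x\<in>X. v x \<noteq> 0) \<and>
    (\<forall>x p c. degree p \<le> Suc m \<longrightarrow> (\<Sum>y\<in>X. v y * poly p (c * (dist x y)\<^sup>2)) = 0)"
proof -
  obtain i :: 'n where True by blast
  obtain L where L: "distinct L" "set L = UNIV - {i}"
    using finite_distinct_list[of "UNIV - {i}"] by auto
  have "Suc (length L) = CARD('n)"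
    using distinct_card[OF L(1)] L(2) card_Suc_Diff1[of UNIV i] by simp
  note basis = card_paraboloid_basis[OF this, of i m]
  obtain v where v: "\<exists>x\<in>X. v x \<noteq> 0" "\<forall>b\<in>paraboloid_basis i L (Suc m). (\<Sum>x\<in>X. v x * b x) = 0"
    using exists_annihilator[OF basis(1) assms(1), of "\<lambda>b. b"] basis(2) card by auto
  have pow: "(\<lambda>y. ((dist x y)\<^sup>2) ^ k) \<in> function_span (paraboloid_basis i L k)" for x k
  proof (induction k)
    case 0
    then show ?case
      using one_in_monomials by (intro function_span_base) (auto simp: paraboloid_basis_def)
  next
    case (Suc k)
    then show ?case using paraboloid_dist_mult[OF L Suc] by simp
  qed
  have mono: "paraboloid_basis i L k \<subseteq> paraboloid_basis i L l" if "k \<le> l" for k l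
    using that by (induction l rule: dec_induct) (use paraboloid_basis_Suc in blast)+
  have ann: "(\<Sum>y\<in>X. v y * ((dist x y)\<^sup>2) ^ k) = 0" if "k \<le> Suc m" for x k
    using function_span_mono[OF pow mono[OF that]] by (rule function_span_annihilated) (use v(2) in blast)
  have "(\<Sum>y\<in>X. v y * poly p (c * (dist x y)\<^sup>2)) = 0" if "degree p \<le> Suc m" for x p c
  proof -
    have "(\<Sum>y\<in>X. v y * poly p (c * (dist x y)\<^sup>2))
        = (\<Sum>y\<in>X. \<Sum>k\<le>degree p. coeff p k * c ^ k * (v y * ((dist x y)\<^sup>2) ^ k))"
      by (simp add: poly_altdef sum_distrib_left power_mult_distrib algebra_simps)
    also have "\<dots> = (\<Sum>k\<le>degree p. \<Sum>y\<in>X. coeff p k * c ^ k * (v y * ((dist x y)\<^sup>2) ^ k))"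
      by (rule sum.swap)
    also have "\<dots> = (\<Sum>k\<le>degree p. coeff p k * c ^ k * (\<Sum>y\<in>X. v y * ((dist x y)\<^sup>2) ^ k))"
      by (simp only: sum_distrib_left)
    also have "\<dots> = 0" using that by (intro sum.neutral ballI) (subst ann, auto)
    finally show ?thesis .
  qed
  with v(1) show ?thesis by blast
qed

section \<open>Nodes with prescribed interpolation weights at zero\<close>

lemma degree_prod_linear: "degree (\<Prod>j\<in>J. [:- a j, 1:] :: real poly) = card J"
  by (subst degree_prod_eq_sum_degree) auto

section \<open>Lagrange interpolation and weights for the value at zero\<close>

definition lagrange_basis :: "nat \<Rightarrow> (nat \<Rightarrow> real) \<Rightarrow> nat \<Rightarrow> real poly" where
  "lagrange_basis s a i =
     smult (1 / (\<Prod>j\<in>{..<s} - {i}. a i - a j)) (\<Prod>j\<in>{..<s} - {i}. [:- a j, 1:])"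

lemma degree_lagrange_basis: "i < s \<Longrightarrow> degree (lagrange_basis s a i) < s"
  unfolding lagrange_basis_def
  by (rule le_less_trans[OF degree_smult_le]) (simp add: degree_prod_linear)

lemma poly_lagrange_basis:
  assumes "inj_on a {..<s}" "i < s" "j < s"
  shows "poly (lagrange_basis s a i) (a j) = (if j = i then 1 else 0)"
proof (cases "j = i")
  case True
  have "(\<Prod>l\<in>{..<s} - {i}. a i - a l) \<noteq> 0"
    using assms by (auto simp: inj_on_def)
  then show ?thesis using True by (simp add: lagrange_basis_def poly_prod)
next
  case False
  then have "(\<Prod>l\<in>{..<s} - {i}. a j - a l) = 0"
    using assms by (intro prod_zero) auto
  then show ?thesis using False by (simp add: lagrange_basis_def poly_prod)
qed

lemma poly_lagrange_basis_0_neq_0: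
  assumes "inj_on a {..<s}" "i < s" "\<And>j. j < s \<Longrightarrow> 0 < a j"
  shows "poly (lagrange_basis s a i) 0 \<noteq> 0"
proof -
  have "(\<Prod>l\<in>{..<s} - {i}. a i - a l) \<noteq> 0" using assms by (auto simp: inj_on_def)
  moreover have "(\<Prod>l\<in>{..<s} - {i}. - a l) \<noteq> 0" using assms(3) by fastforce
  ultimately show ?thesis by (simp add: lagrange_basis_def poly_prod)
qed

text \<open>The value at zero is extrapolated from the values at the nodes. The nodes may coincide
  here, so the condition passes to limits in which nodes could a priori merge.\<close>

definition weights_at_zero :: "nat \<Rightarrow> (nat \<Rightarrow> real) \<Rightarrow> (nat \<Rightarrow> real) \<Rightarrow> bool" where
  "weights_at_zero s K a \<longleftrightarrow> (\<forall>p. degree p < s \<longrightarrow> (\<Sum>i<s. K i * poly p (a i)) = poly p 0)"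

text \<open>Test the defining identity on the i-th Lagrange polynomial.\<close>

lemma weights_at_zero_eq_lagrange:
  assumes "weights_at_zero s K a" "inj_on a {..<s}" "i < s"
  shows "K i = poly (lagrange_basis s a i) 0"
proof -
  have "poly (lagrange_basis s a i) 0 = (\<Sum>j<s. K j * poly (lagrange_basis s a i) (a j))"
    using assms degree_lagrange_basis by (simp add: weights_at_zero_def)
  also have "\<dots> = (\<Sum>j<s. if j = i then K j else 0)"
    using assms by (intro sum.cong) (auto simp: poly_lagrange_basis)
  also have "\<dots> = K i" using assms by simp
  finally show ?thesis by simp
qed

text \<open>A vanishing tail sum would give a polynomial of degree below \<open>s\<close> whose derivative has \<open>s - 1\<close>
  zeros by Rolle's theorem: one between any two consecutive points of \<open>0, a 0, \<dots>, a (s - 1)\<close>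
  except where the value jumps from 0 to 1.\<close>

lemma weights_at_zero_tail_neq_0:
  assumes w: "weights_at_zero s K a" and mono: "strict_mono_on {..<s} a"
    and pos: "\<And>j. j < s \<Longrightarrow> 0 < a j" and k: "k < s"
  shows "(\<Sum>i\<in>{k..<s}. K i) \<noteq> 0"
proof
  assume tail: "(\<Sum>i\<in>{k..<s}. K i) = 0"
  have inj: "inj_on a {..<s}" using mono by (rule strict_mono_on_imp_inj_on)
  \<comment> \<open>This p interpolates the step from 0 to 1 at index k, so its value at 0 is the
    tail sum.\<close>
  define p where "p = (\<Sum>i\<in>{k..<s}. lagrange_basis s a i)"
  have deg: "degree p < s"
    unfolding p_def using k by (intro degree_sum_less) (auto simp: degree_lagrange_basis)
  have val: "poly p (a j) = (if k \<le> j then 1 else 0)" if "j < s" for j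
  proof -
    have "poly p (a j) = (\<Sum>i\<in>{k..<s}. if i = j then 1 else 0)"
      unfolding p_def poly_sum using that inj by (intro sum.cong) (auto simp: poly_lagrange_basis)
    then show ?thesis using that by simp
  qed
  have "poly p 0 = (\<Sum>i<s. K i * poly p (a i))" using w deg by (simp add: weights_at_zero_def)
  also have "\<dots> = (\<Sum>i<s. if k \<le> i then K i else 0)" using val by (intro sum.cong) auto
  also have "\<dots> = (\<Sum>i\<in>{i\<in>{..<s}. k \<le> i}. K i)" by (rule sum.inter_filter[symmetric]) simp
  also have "{i\<in>{..<s}. k \<le> i} = {k..<s}" by auto
  finally have p0: "poly p 0 = 0" using tail by simp
  \<comment> \<open>Prepending 0 shifts the indices by one: the jump now lies between
    \<open>e k\<close> and \<open>e (Suc k)\<close>, the one interval where Rolle's theorem is not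
    applied.\<close>
  define e where "e j = (case j of 0 \<Rightarrow> 0 | Suc i \<Rightarrow> a i)" for j
  have e_less: "e j < e (Suc j)" if "j < s" for j
    using that pos mono by (auto simp: e_def strict_mono_on_def split: nat.split)
  have e_le: "e i \<le> e j" if "i \<le> j" "j \<le> s" for i j
    using that
  proof (induction j rule: dec_induct)
    case (step n)
    then show ?case using e_less[of n] by simp
  qed simp
  have e_val: "poly p (e j) = (if k < j then 1 else 0)" if "j \<le> s" for j
    using that val p0 by (auto simp: e_def split: nat.split)
  have "\<exists>x. e j < x \<and> x < e (Suc j) \<and> poly (pderiv p) x = 0" if j: "j \<in> {..<s} - {k}" for j
  proof -
    have "poly p (e j) = poly p (e (Suc j))" using j by (simp add: e_val)
    moreover obtain x where "e j < x" "x < e (Suc j)"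
      "poly p (e (Suc j)) - poly p (e j) = (e (Suc j) - e j) * poly (pderiv p) x"
      using poly_MVT[OF e_less[of j]] j by auto
    ultimately show ?thesis using e_less[of j] j by auto
  qed
  then obtain c where c: "\<And>j. j \<in> {..<s} - {k} \<Longrightarrow> e j < c j \<and> c j < e (Suc j) \<and> poly (pderiv p) (c j) = 0"
    by metis
  have c_less: "c i < c j" if "i \<in> {..<s} - {k}" "j \<in> {..<s} - {k}" "i < j" for i j
    using c[OF that(1)] c[OF that(2)] e_le[of "Suc i" j] that by simp
  have inj_c: "inj_on c ({..<s} - {k})"
    using c_less by (intro linorder_inj_onI) fastforce+
  have "poly p (a k) = 1" using val k by simp
  have "degree p \<noteq> 0"
  proof
    assume "degree p = 0"
    then obtain c where "p = [:c:]" by (rule degree_eq_zeroE)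
    then show False using p0 \<open>poly p (a k) = 1\<close> by simp
  qed
  then have nz: "pderiv p \<noteq> 0" by (simp add: pderiv_eq_0_iff)
  \<comment> \<open>There are s - 1 distinct zeros, but the derivative has degree at most s -
    2.\<close>
  have "s - 1 = card (c ` ({..<s} - {k}))" using inj_c k by (simp add: card_image)
  also have "\<dots> \<le> card {x. poly (pderiv p) x = 0}"
    using c nz by (intro card_mono poly_roots_finite) auto
  also have "\<dots> \<le> degree (pderiv p)" using nz by (rule card_poly_roots_bound)
  also have "\<dots> = degree p - 1" by (rule degree_pderiv)
  finally show False using deg \<open>degree p \<noteq> 0\<close> by simp
qed

text \<open>With fewer than s distinct nonzero nodes, the polynomial t times the product of t - c
  over the nodes c other than 0 and 1 has degree below s. It vanishes at 0 and at all nodes except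
  those equal to 1, and these form a final segment, so a tail sum would have to vanish.\<close>

lemma weights_at_zero_nondegenerate:
  assumes w: "weights_at_zero s K b" and mono: "\<And>i j. i \<le> j \<Longrightarrow> j < s \<Longrightarrow> b i \<le> b j"
    and one: "b (s - 1) = 1" "0 < s"
    and tail: "\<And>k. k < s \<Longrightarrow> (\<Sum>i\<in>{k..<s}. K i) \<noteq> 0"
  shows "inj_on b {..<s} \<and> 0 \<notin> b ` {..<s}"
proof -
  define C where "C = b ` {..<s} - {0}"
  have fin: "finite C" by (simp add: C_def)
  have oneC: "1 \<in> C" using one unfolding C_def by force
  have "\<not> card C < s"
  proof
    assume less: "card C < s"
    define p where "p = [:0, 1:] * (\<Prod>c\<in>C - {1}. [:- c, 1:])"
    have "(\<Prod>c\<in>C - {1}. [:- c, 1:]) \<noteq> (0 :: real poly)" using fin by auto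
    then have "degree p = 1 + card (C - {1})"
      unfolding p_def by (subst degree_mult_eq) (auto simp: degree_prod_linear[of "\<lambda>c. c"])
    also have "\<dots> = card C" using fin oneC by (metis card_Suc_Diff1 plus_1_eq_Suc)
    finally have "(\<Sum>i<s. K i * poly p (b i)) = poly p 0" using w less by (simp add: weights_at_zero_def)
    also have "\<dots> = 0" by (simp add: p_def)
    finally have sum0: "(\<Sum>i<s. K i * poly p (b i)) = 0" .
    \<comment> \<open>By monotonicity the nodes equal to 1 are exactly those from index k
      on.\<close>
    define k where "k = (LEAST i. b i = 1)"
    have k: "b k = 1" "k < s"
      using LeastI[of "\<lambda>i. b i = 1", OF one(1)] Least_le[of "\<lambda>i. b i = 1", OF one(1)] one(2)
      by (auto simp: k_def)
    have le1: "b i \<le> 1" if "i < s" for i using mono[of i "s - 1"] one that by simp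
    have b1: "b i = 1 \<longleftrightarrow> k \<le> i" if "i < s" for i
      using mono[of k i] k le1[OF that] that Least_le[of "\<lambda>i. b i = 1" i] by (auto simp: k_def)
    have "poly p (b i) = (if k \<le> i then poly p 1 else 0)" if "i < s" for i
    proof (cases "k \<le> i")
      case True
      then show ?thesis using b1[OF that] by simp
    next
      case False
      then have "b i = 0 \<or> b i \<in> C - {1}" using b1 that by (auto simp: C_def)
      then have "poly p (b i) = 0" using fin by (auto simp: p_def poly_prod)
      then show ?thesis using False by simp
    qed
    then have "0 = (\<Sum>i<s. (if k \<le> i then K i else 0) * poly p 1)"
      by (subst sum0[symmetric]) (intro sum.cong, auto)
    also have "\<dots> = (\<Sum>i<s. if k \<le> i then K i else 0) * poly p 1" by (rule sum_distrib_right[symmetric])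
    also have "(\<Sum>i<s. if k \<le> i then K i else 0) = (\<Sum>i\<in>{i\<in>{..<s}. k \<le> i}. K i)"
      by (rule sum.inter_filter[symmetric]) simp
    also have "{i\<in>{..<s}. k \<le> i} = {k..<s}" by auto
    finally have "poly p 1 = 0" using tail[OF k(2)] by simp
    then show False using fin by (auto simp: p_def poly_prod)
  qed
  moreover have "card C \<le> card (b ` {..<s})" unfolding C_def by (intro card_mono) auto
  moreover have "card (b ` {..<s}) \<le> s" using card_image_le[of "{..<s}" b] by simp
  ultimately have "card (b ` {..<s}) = s" "card C = card (b ` {..<s})" by simp_all
  moreover from this have "C = b ` {..<s}" by (intro card_subset_eq) (auto simp: C_def)
  ultimately show ?thesis by (auto simp: C_def intro: eq_card_imp_inj_on)
qed

section \<open>Compactness and discreteness of the nodes with given weights\<close>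

text \<open>Bolzano-Weierstrass, passing to one further subsequence for each coordinate.\<close>

lemma bounded_coordinates_convergent_subseq:
  fixes f :: "nat \<Rightarrow> nat \<Rightarrow> real"
  assumes "\<And>n i. i < s \<Longrightarrow> \<bar>f n i\<bar> \<le> B"
  shows "\<exists>r l. strict_mono r \<and> (\<forall>i<s. (\<lambda>n. f (r n) i) \<longlonglongrightarrow> l i)"
  using assms
proof (induction s)
  case 0
  then show ?case by (intro exI[of _ id]) (auto simp: strict_mono_def)
next
  case (Suc s)
  then obtain r l where r: "strict_mono r" "\<forall>i<s. (\<lambda>n. f (r n) i) \<longlonglongrightarrow> l i" by fastforce
  have "bounded (range (\<lambda>n. f (r n) s))"
    using Suc.prems by (intro boundedI[of _ B]) auto
  then obtain c q where q: "strict_mono q" "((\<lambda>n. f (r n) s) \<circ> q) \<longlonglongrightarrow> c"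
    using bounded_imp_convergent_subsequence by blast
  have "(\<lambda>n. f ((r \<circ> q) n) i) \<longlonglongrightarrow> (if i = s then c else l i)" if "i < Suc s" for i
  proof (cases "i = s")
    case True
    then show ?thesis using q by (simp add: o_def)
  next
    case False
    then show ?thesis
      using LIMSEQ_subseq_LIMSEQ[OF _ q(1), of "\<lambda>n. f (r n) i"] r that by (simp add: o_def)
  qed
  then show ?case
    using strict_mono_o[OF r(1) q(1)]
    by (intro exI[of _ "r \<circ> q"] exI[of _ "\<lambda>i. if i = s then c else l i"]) blast
qed

text \<open>The last node 1 fixes the scale. The value 0 from index s on makes a node function
  determined by its first s values, so that finiteness of a set of such functions is
  meaningful.\<close>

definition normalized_nodes :: "nat \<Rightarrow> (nat \<Rightarrow> real) \<Rightarrow> bool" where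
  "normalized_nodes s a \<longleftrightarrow> strict_mono_on {..<s} a \<and> (\<forall>i<s. 0 < a i) \<and> a (s - 1) = 1 \<and> (\<forall>i\<ge>s. a i = 0)"

text \<open>An infinite family would have a subsequence converging to some \<open>b\<close>, which is nondegenerate
  by the tail sums. Any limit \<open>U\<close> of normalised difference vectors then lies in the kernel of the
  derivative of the power sum equations at \<open>b\<close>, a Vandermonde system.\<close>

lemma finite_normalized_nodes:
  assumes s: "0 < s"
  shows "finite {a. normalized_nodes s a \<and> weights_at_zero s K a}" (is "finite ?S")
proof (rule ccontr)
  assume "infinite ?S"
  then obtain g :: "nat \<Rightarrow> nat \<Rightarrow> real" where g: "inj g" "range g \<subseteq> ?S"
    using infinite_countable_subset by blast
  have gS: "normalized_nodes s (g n)" "weights_at_zero s K (g n)" for n using g by auto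
  have g_inj: "inj_on (g n) {..<s}" for n
    using gS(1)[of n] by (auto simp: normalized_nodes_def intro: strict_mono_on_imp_inj_on)
  have g_pos: "0 < g n i" if "i < s" for n i using gS(1)[of n] that by (simp add: normalized_nodes_def)
  have g_mono: "g n i \<le> g n j" if "i \<le> j" "j < s" for n i j
    using gS(1)[of n] that unfolding normalized_nodes_def
    by (metis lessThan_iff order_le_less order_le_less_trans strict_mono_on_def)
  have g_one: "g n (s - 1) = 1" for n using gS(1)[of n] by (simp add: normalized_nodes_def)
  have g_le: "g n i \<le> 1" if "i < s" for n i using g_mono[of i "s - 1" n] g_one that by simp
  have tail: "(\<Sum>i\<in>{k..<s}. K i) \<noteq> 0" if "k < s" for k
    using weights_at_zero_tail_neq_0[OF gS(2)[of 0] _ _ that] gS(1)[of 0] by (auto simp: normalized_nodes_def)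
  have K_nz: "K i \<noteq> 0" if "i < s" for i
    using weights_at_zero_eq_lagrange[OF gS(2)[of 0] g_inj that]
      poly_lagrange_basis_0_neq_0[OF g_inj that, of 0] g_pos by simp
  have "\<bar>g n i\<bar> \<le> 1" if "i < s" for n i using g_pos[OF that, of n] g_le[OF that, of n] by simp
  then obtain r l where r: "strict_mono r" "\<forall>i<s. (\<lambda>n. g (r n) i) \<longlonglongrightarrow> l i"
    using bounded_coordinates_convergent_subseq[of s g 1] by blast
  \<comment> \<open>Padding with 0 as in \<open>normalized_nodes\<close>, so that differing from b
    means differing in one of the first s coordinates.\<close>
  define b where "b i = (if i < s then l i else 0)" for i
  have lim_b: "(\<lambda>n. g (r n) i) \<longlonglongrightarrow> b i" if "i < s" for i using r that by (simp add: b_def)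
  have w_b: "weights_at_zero s K b" unfolding weights_at_zero_def
  proof (intro allI impI)
    fix p :: "real poly" assume deg: "degree p < s"
    have "(\<lambda>n. \<Sum>i<s. K i * poly p (g (r n) i)) \<longlonglongrightarrow> (\<Sum>i<s. K i * poly p (b i))"
      using lim_b by (intro tendsto_intros) auto
    moreover have "(\<Sum>i<s. K i * poly p (g (r n) i)) = poly p 0" for n
      using gS(2) deg by (simp add: weights_at_zero_def)
    ultimately show "(\<Sum>i<s. K i * poly p (b i)) = poly p 0" by (simp add: LIMSEQ_const_iff)
  qed
  have b_mono: "b i \<le> b j" if "i \<le> j" "j < s" for i j
    using that g_mono[OF that] by (intro LIMSEQ_le[OF lim_b lim_b]) auto
  have b_one: "b (s - 1) = 1"
    using lim_b[of "s - 1"] s g_one by (simp add: LIMSEQ_const_iff)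
  have b_inj: "inj_on b {..<s}"
    using weights_at_zero_nondegenerate[OF w_b b_mono b_one s tail] by blast
  \<comment> \<open>Injectivity of g lets the subsequence hit b at most once. Dropping an initial
    segment makes the division by \<open>m n\<close> below legitimate.\<close>
  have "\<exists>N. \<forall>n\<ge>N. g (r n) \<noteq> b"
  proof (cases "\<exists>n. g (r n) = b")
    case True
    then obtain n where "g (r n) = b" by blast
    then have "\<forall>m\<ge>Suc n. g (r m) \<noteq> b"
      using strict_mono_less[OF r(1)] inj_eq[OF g(1)] by (metis Suc_le_eq less_irrefl)
    then show ?thesis by blast
  qed blast
  then obtain N where N: "\<And>n. n \<ge> N \<Longrightarrow> g (r n) \<noteq> b" by blast
  define h where "h n = g (r (n + N))" for n
  have lim_h: "(\<lambda>n. h n i) \<longlonglongrightarrow> b i" if "i < s" for i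
    unfolding h_def using lim_b[OF that] by (rule LIMSEQ_ignore_initial_segment)
  define m where "m n = (\<Sum>i<s. \<bar>h n i - b i\<bar>)" for n
  have m_pos: "m n > 0" for n
  proof -
    have "h n \<noteq> b" using N[of "n + N"] by (simp add: h_def)
    then obtain i where i: "h n i \<noteq> b i" by blast
    moreover have "i < s"
    proof (rule ccontr)
      assume "\<not> i < s"
      then show False using i gS(1)[of "r (n + N)"] by (simp add: h_def b_def normalized_nodes_def)
    qed
    ultimately show ?thesis unfolding m_def by (intro sum_pos2[of _ i]) auto
  qed
  define u where "u n i = (h n i - b i) / m n" for n i
  have u_sum: "(\<Sum>i<s. \<bar>u n i\<bar>) = 1" for n
    using m_pos[of n] by (simp add: u_def abs_divide sum_divide_distrib[symmetric] m_def[symmetric])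
  have "\<bar>u n i\<bar> \<le> 1" if "i < s" for n i
    using member_le_sum[of i "{..<s}" "\<lambda>i. \<bar>u n i\<bar>"] that u_sum[of n] by simp
  then obtain q U where q: "strict_mono q" "\<forall>i<s. (\<lambda>n. u (q n) i) \<longlonglongrightarrow> U i"
    using bounded_coordinates_convergent_subseq[of s u 1] by blast
  have "(\<lambda>n. \<Sum>i<s. \<bar>u (q n) i\<bar>) \<longlonglongrightarrow> (\<Sum>i<s. \<bar>U i\<bar>)"
    using q(2) by (intro tendsto_intros) auto
  then have U_sum: "(\<Sum>i<s. \<bar>U i\<bar>) = 1" using u_sum by (simp add: LIMSEQ_const_iff)
  have pow: "(\<Sum>i<s. K i * U i * b i ^ k) = 0" if k: "Suc k < s" for k
  proof -
    have 1: "(\<Sum>i<s. K i * a i ^ Suc k) = 0" if "weights_at_zero s K a" for a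
    proof -
      have "(\<Sum>i<s. K i * poly (monom 1 (Suc k)) (a i)) = poly (monom 1 (Suc k)) 0"
        using that k unfolding weights_at_zero_def by (simp add: degree_monom_eq)
      then show ?thesis by (simp add: poly_monom)
    qed
    \<comment> \<open>Subtract the power sum equations at \<open>h n\<close> and b, factor out
      \<open>h n i - b i\<close>, and divide by \<open>m n\<close>. In the limit the inner sum
      becomes (k + 1) times the k-th power of \<open>b i\<close>.\<close>
    have 2: "(\<Sum>i<s. K i * u n i * (\<Sum>j<Suc k. h n i ^ j * b i ^ (k - j))) = 0" for n
    proof -
      have "(h n i - b i) * (\<Sum>j<Suc k. h n i ^ j * b i ^ (k - j)) = h n i ^ Suc k - b i ^ Suc k" for i
        by (subst power_diff_sumr2) (simp add: mult.commute)
      then have "K i * u n i * (\<Sum>j<Suc k. h n i ^ j * b i ^ (k - j))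
          = (K i * h n i ^ Suc k - K i * b i ^ Suc k) / m n" for i
        by (simp add: u_def right_diff_distrib[symmetric] del: power_Suc sum.lessThan_Suc)
      then have "(\<Sum>i<s. K i * u n i * (\<Sum>j<Suc k. h n i ^ j * b i ^ (k - j)))
        = ((\<Sum>i<s. K i * h n i ^ Suc k) - (\<Sum>i<s. K i * b i ^ Suc k)) / m n"
        by (simp only: sum_divide_distrib[symmetric] sum_subtractf)
      also have "\<dots> = 0" using 1[OF w_b] 1[of "h n"] gS(2) by (simp add: h_def)
      finally show ?thesis .
    qed
    have lim_hq: "(\<lambda>n. h (q n) i) \<longlonglongrightarrow> b i" if "i < s" for i
      using LIMSEQ_subseq_LIMSEQ[OF lim_h[OF that] q(1)] by (simp add: o_def)
    have "(\<lambda>n. \<Sum>i<s. K i * u (q n) i * (\<Sum>j<Suc k. h (q n) i ^ j * b i ^ (k - j)))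
      \<longlonglongrightarrow> (\<Sum>i<s. K i * U i * (\<Sum>j<Suc k. b i ^ j * b i ^ (k - j)))"
      using q(2) lim_hq by (intro tendsto_intros) auto
    then have "(\<Sum>i<s. K i * U i * (\<Sum>j<Suc k. b i ^ j * b i ^ (k - j))) = 0"
      by (simp only: 2 LIMSEQ_const_iff)
    moreover have "(\<Sum>j<Suc k. b i ^ j * b i ^ (k - j)) = real (Suc k) * b i ^ k" for i
      by (simp add: power_add[symmetric] del: sum.lessThan_Suc)
    ultimately have "real (Suc k) * (\<Sum>i<s. K i * U i * b i ^ k) = 0"
      by (simp add: sum_distrib_left algebra_simps del: sum.lessThan_Suc of_nat_Suc)
    then show ?thesis by simp
  qed
  have poly0: "(\<Sum>i<s. K i * U i * poly p (b i)) = 0" if "Suc (degree p) < s" for p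
  proof -
    have "(\<Sum>i<s. K i * U i * poly p (b i)) = (\<Sum>i<s. \<Sum>k\<le>degree p. coeff p k * (K i * U i * b i ^ k))"
      by (simp add: poly_altdef sum_distrib_left algebra_simps)
    also have "\<dots> = (\<Sum>k\<le>degree p. \<Sum>i<s. coeff p k * (K i * U i * b i ^ k))" by (rule sum.swap)
    also have "\<dots> = (\<Sum>k\<le>degree p. coeff p k * (\<Sum>i<s. K i * U i * b i ^ k))"
      by (simp only: sum_distrib_left)
    also have "\<dots> = 0" using that by (intro sum.neutral ballI) (simp add: pow)
    finally show ?thesis .
  qed
  \<comment> \<open>All last nodes equal 1. This supplies the missing equation, since the power sums
    give only s - 1 equations for the s unknowns \<open>U i\<close>.\<close>
  have U_last: "U (s - 1) = 0"
  proof -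
    have "u n (s - 1) = 0" for n using g_one b_one by (simp add: u_def h_def)
    then show ?thesis using q(2)[rule_format, of "s - 1"] s by (simp add: LIMSEQ_const_iff)
  qed
  have U_0: "U i = 0" if i: "i < s" for i
  proof (cases "i = s - 1")
    case False
    \<comment> \<open>Isolates \<open>U i\<close>: index s - 1 is left out of the product because
      \<open>U_last\<close> handles it, which keeps the degree at s - 2, as \<open>poly0\<close>
      demands.\<close>
    define p where "p = (\<Prod>j\<in>{..<s - 1} - {i}. [:- b j, 1:])"
    have "degree p = s - 2" using i False by (simp add: p_def degree_prod_linear)
    then have "(\<Sum>j<s. K j * U j * poly p (b j)) = 0" using i False by (intro poly0) simp
    moreover have "K j * U j * poly p (b j) = (if j = i then K i * U i * poly p (b i) else 0)" if "j < s" for j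
    proof (cases "j = i \<or> j = s - 1")
      case False
      then have "j \<in> {..<s - 1} - {i}" using that by auto
      then have "poly p (b j) = 0" by (auto simp: p_def poly_prod)
      then show ?thesis using False by simp
    qed (use U_last in auto)
    then have "(\<Sum>j<s. K j * U j * poly p (b j)) = (\<Sum>j<s. if j = i then K i * U i * poly p (b i) else 0)"
      by (intro sum.cong) simp_all
    ultimately have "(\<Sum>j<s. if j = i then K i * U i * poly p (b i) else 0) = 0" by (simp only:)
    then have "K i * U i * poly p (b i) = 0" using i by simp
    moreover have "poly p (b i) \<noteq> 0"
      using b_inj i by (auto simp: p_def poly_prod inj_on_def)
    ultimately show ?thesis using K_nz[OF i] by simp
  qed (use U_last in simp)
  then show False using U_sum by simp
qed

section \<open>Congruent finite sets\<close>

text \<open>The reflection in the hyperplane bisecting the segment from p to q perpendicularly. For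
  p = q it is the identity.\<close>

definition bisector_reflection :: "'a::real_inner \<Rightarrow> 'a \<Rightarrow> 'a \<Rightarrow> 'a" where
  "bisector_reflection p q z =
     z - (2 * ((z - midpoint p q) \<bullet> (p - q)) / ((p - q) \<bullet> (p - q))) *\<^sub>R (p - q)"

lemma dist_bisector_reflection:
  "dist (bisector_reflection p q y) (bisector_reflection p q z) = dist y z"
proof (cases "p = q")
  case False
  define w where "w = p - q"
  define t where "t = (y - z) \<bullet> w / (w \<bullet> w)"
  have ww: "w \<bullet> w \<noteq> 0" using False by (simp add: w_def)
  \<comment> \<open>The midpoint cancels, leaving the linear reflection of y - z; here t w is the
    projection of y - z onto the line spanned by w.\<close>
  have "bisector_reflection p q y - bisector_reflection p q z = (y - z) - (2 * t) *\<^sub>R w"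
    unfolding bisector_reflection_def w_def[symmetric] t_def
    by (simp add: algebra_simps inner_diff_left diff_divide_distrib add_divide_distrib)
  moreover have "((y - z) - (2 * t) *\<^sub>R w) \<bullet> ((y - z) - (2 * t) *\<^sub>R w) = (y - z) \<bullet> (y - z)"
  proof -
    have "((y - z) - (2 * t) *\<^sub>R w) \<bullet> ((y - z) - (2 * t) *\<^sub>R w)
      = (y - z) \<bullet> (y - z) - 4 * t * ((y - z) \<bullet> w) + 4 * t * (t * (w \<bullet> w))"
      by (simp add: inner_diff_left inner_diff_right inner_commute algebra_simps)
    also have "t * (w \<bullet> w) = (y - z) \<bullet> w" using ww by (simp add: t_def)
    finally show ?thesis by simp
  qed
  ultimately show ?thesis by (simp add: dist_norm norm_eq_sqrt_inner)
qed (simp add: bisector_reflection_def)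

lemma bisector_reflection_left: "bisector_reflection p q p = q"
proof (cases "p = q")
  case False
  have "p - midpoint p q = (1/2) *\<^sub>R (p - q)"
    by (simp add: midpoint_def algebra_simps flip: scaleR_add_left)
  then show ?thesis using False by (simp add: bisector_reflection_def)
qed (simp add: bisector_reflection_def)

lemma bisector_reflection_fix:
  assumes "dist z p = dist z q"
  shows "bisector_reflection p q z = z"
proof -
  have "(z - midpoint p q) \<bullet> (p - q) = (1/2) * ((dist z q)\<^sup>2 - (dist z p)\<^sup>2)"
    by (simp add: midpoint_def dist_norm power2_norm_eq_inner inner_diff_left inner_diff_right
        inner_add_left inner_add_right inner_commute algebra_simps)
  then show ?thesis using assms by (simp add: bisector_reflection_def)
qed

text \<open>Points are matched one at a time: a reflection moves \<open>f (x n)\<close> to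
  \<open>y n\<close>. It fixes the earlier \<open>y i\<close>, which are equidistant from these two
  points.\<close>

lemma isometry_extending_finite:
  fixes x y :: "nat \<Rightarrow> 'a::real_inner"
  assumes "\<And>i j. i < n \<Longrightarrow> j < n \<Longrightarrow> dist (x i) (x j) = dist (y i) (y j)"
  shows "\<exists>f. (\<forall>u v. dist (f u) (f v) = dist u v) \<and> (\<forall>i<n. f (x i) = y i)"
  using assms
proof (induction n)
  case 0
  then show ?case by (intro exI[of _ "\<lambda>u. u"]) simp
next
  case (Suc n)
  then obtain f where f: "\<forall>u v. dist (f u) (f v) = dist u v" "\<forall>i<n. f (x i) = y i"
    by (metis less_SucI)
  let ?r = "bisector_reflection (f (x n)) (y n)"
  have "?r (f (x i)) = y i" if "i < Suc n" for i
  proof (cases "i = n")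
    case False
    then have i: "i < n" using that by simp
    have "dist (y i) (f (x n)) = dist (f (x i)) (f (x n))" using f(2) i by simp
    also have "\<dots> = dist (y i) (y n)" using f(1) Suc.prems[of i n] i by simp
    finally show ?thesis using f i by (simp add: bisector_reflection_fix)
  qed (simp add: bisector_reflection_left)
  then show ?case using f
    by (intro exI[of _ "?r \<circ> f"]) (simp add: dist_bisector_reflection)
qed

section \<open>Large distance sets\<close>

text \<open>Division by the largest distance removes the scaling freedom and puts the sorted squared
  distances into the form of \<open>normalized_nodes\<close>.\<close>

lemma squared_distances_enumeration:
  assumes X: "s_distance_set s X" and s: "s > 0"
  defines "M \<equiv> Max (dist_set X)"
  shows "\<exists>a. normalized_nodes s a \<and> (\<forall>x\<in>X. \<forall>y\<in>X. x \<noteq> y \<longrightarrow> (\<exists>i<s. (dist x y / M)\<^sup>2 = a i)) \<and> M > 0"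
proof -
  let ?D = "dist_set X"
  have D: "finite ?D" "card ?D = s"
    using X s by (auto simp: s_distance_set_def card_ge_0_finite)
  then have ne: "?D \<noteq> {}" using s by auto
  have pos: "0 < t" if "t \<in> ?D" for t using that by (auto simp: dist_set_def)
  have M: "M \<in> ?D" "\<And>t. t \<in> ?D \<Longrightarrow> t \<le> M" using D ne by (auto simp: M_def)
  define L where "L = sorted_list_of_set ?D"
  have L: "sorted_wrt (<) L" "distinct L" "set L = ?D" "length L = s" using D by (auto simp: L_def)
  define a where "a i = (if i < s then (L ! i / M)\<^sup>2 else 0)" for i
  have nth: "L ! i \<in> ?D" if "i < s" for i using that L by (metis nth_mem)
  have less: "L ! i < L ! j" if "i < j" "j < s" for i j
    using that L by (intro sorted_wrt_nth_less) auto
  have "strict_mono_on {..<s} a"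
  proof (rule strict_mono_onI)
    fix i j assume ij: "i \<in> {..<s}" "j \<in> {..<s}" "i < j"
    then have "L ! i / M < L ! j / M" using less pos[OF M(1)] by (simp add: divide_strict_right_mono)
    moreover have "0 \<le> L ! i / M" using pos[OF nth[of i]] pos[OF M(1)] ij by simp
    ultimately show "a i < a j" using ij by (simp add: a_def power_strict_mono)
  qed
  moreover have "0 < a i" if "i < s" for i
    using pos[OF nth[OF that]] pos[OF M(1)] that by (simp add: a_def)
  moreover have "a (s - 1) = 1"
  proof -
    obtain i where i: "i < s" "L ! i = M" using M(1) L by (metis in_set_conv_nth)
    have "\<not> i < s - 1" using less[of i "s - 1"] i M(2)[OF nth[of "s - 1"]] s by force
    then have "i = s - 1" using i(1) by linarith
    then have "L ! (s - 1) = M" using i(2) by simp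
    then show ?thesis using s pos[OF M(1)] by (simp add: a_def)
  qed
  moreover have "\<forall>i\<ge>s. a i = 0" by (simp add: a_def)
  ultimately have "normalized_nodes s a" by (simp add: normalized_nodes_def)
  moreover have *: "\<exists>i<s. (dist x y / M)\<^sup>2 = a i" if "x \<in> X" "y \<in> X" "x \<noteq> y" for x y
  proof -
    have "dist x y \<in> ?D" using that by (auto simp: dist_set_def)
    then obtain i where "i < s" "L ! i = dist x y" using L by (metis in_set_conv_nth)
    then show ?thesis by (intro exI[of _ i]) (simp add: a_def)
  qed
  ultimately show ?thesis using pos[OF M(1)] by blast
qed

text \<open>Otherwise there is an annihilator for degree s. Apply it to the product of the factors t
  - r^2 over all distances r, centred at a point z with \<open>v z\<close> nonzero: only the term y
  = z survives, and the product is nonzero at 0. The bound leaves finitely many sizes of X.\<close>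

lemma card_distance_set_le:
  fixes X :: "(real ^ 'n::finite) set"
  assumes X: "s_distance_set s X" and s: "s > 0"
  shows "card X \<le> (CARD('n) + s choose s) + (CARD('n) + (s - 1) choose (s - 1))"
proof (rule ccontr)
  assume "\<not> ?thesis"
  then have big: "(CARD('n) + Suc (s - 1) choose Suc (s - 1)) + (CARD('n) + (s - 1) choose (s - 1)) < card X"
    using s by simp
  have fin: "finite X" using X by (simp add: s_distance_set_def)
  obtain v z where z: "z \<in> X" "v z \<noteq> 0" and
    v: "\<And>x p c. degree p \<le> Suc (s - 1) \<Longrightarrow> (\<Sum>y\<in>X. v y * poly p (c * (dist x y)\<^sup>2)) = 0"
    using exists_distance_annihilator[OF fin big] by blast
  let ?D = "dist_set X"
  have D: "finite ?D" "card ?D = s" using X s by (auto simp: s_distance_set_def card_ge_0_finite)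
  define p where "p = (\<Prod>t\<in>?D. [:- t\<^sup>2, 1:])"
  have "(\<Sum>y\<in>X. v y * poly p (1 * (dist z y)\<^sup>2)) = 0"
    using D s by (intro v) (simp add: p_def degree_prod_linear)
  moreover have "v y * poly p (1 * (dist z y)\<^sup>2) = (if y = z then v z * poly p 0 else 0)" if "y \<in> X" for y
  proof (cases "y = z")
    case False
    then have "dist z y \<in> ?D" using that z by (auto simp: dist_set_def)
    then have "poly p ((dist z y)\<^sup>2) = 0" using D by (auto simp: p_def poly_prod)
    then show ?thesis using False by simp
  qed simp
  then have "(\<Sum>y\<in>X. v y * poly p (1 * (dist z y)\<^sup>2)) = (\<Sum>y\<in>X. if y = z then v z * poly p 0 else 0)"
    by (rule sum.cong[OF refl])
  ultimately have "(\<Sum>y\<in>X. if y = z then v z * poly p 0 else 0) = 0" by (simp only:)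
  then have "poly p 0 = 0" using z fin by simp
  then show False using D by (auto simp: p_def poly_prod dist_set_def)
qed

section \<open>Finitely many weights and distance ratios\<close>

text \<open>The eigenvalues of symmetric 0/1 matrices of order n. Extensional functions on index
  pairs make the matrices finite in number.\<close>

definition binary_eigenvalues :: "nat \<Rightarrow> real set" where
  "binary_eigenvalues n = (\<Union>A\<in>{A \<in> {..<n} \<times> {..<n} \<rightarrow>\<^sub>E {0, 1}. \<forall>p<n. \<forall>q<n. A (p, q) = A (q, p)}.
     {k. \<exists>v. (\<exists>p<n. v p \<noteq> 0) \<and> (\<forall>p<n. (\<Sum>q<n. A (p, q) * v q) = k * v p)})"

lemma finite_binary_eigenvalues: "finite (binary_eigenvalues n)"
  unfolding binary_eigenvalues_def
proof (rule finite_UN_I)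
  show "finite {A \<in> {..<n} \<times> {..<n} \<rightarrow>\<^sub>E {0, 1 :: real}. \<forall>p<n. \<forall>q<n. A (p, q) = A (q, p)}"
    by (rule finite_subset[of _ "{..<n} \<times> {..<n} \<rightarrow>\<^sub>E {0, 1}"]) (use finite_PiE[of "{..<n} \<times> {..<n}" "\<lambda>_. {0, 1 :: real}"] in auto)
next
  fix A :: "nat \<times> nat \<Rightarrow> real"
  assume "A \<in> {A \<in> {..<n} \<times> {..<n} \<rightarrow>\<^sub>E {0, 1}. \<forall>p<n. \<forall>q<n. A (p, q) = A (q, p)}"
  then show "finite {k. \<exists>v. (\<exists>p<n. v p \<noteq> 0) \<and> (\<forall>p<n. (\<Sum>q<n. A (p, q) * v q) = k * v p)}"
    using finite_symmetric_eigenvalues[of "{..<n}" "\<lambda>p q. A (p, q)"] by (simp add: Bex_def Ball_def)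
qed

text \<open>With \<open>A\<^sub>i\<close> the adjacency matrix of the distance with normalised square \<open>a i\<close>, an annihilator \<open>v\<close>
  applied to the \<open>i\<close>-th Lagrange polynomial gives \<open>A\<^sub>i v = - K i v\<close>. Applied to an arbitrary
  polynomial it then shows that the \<open>K i\<close> are the interpolation weights at zero.\<close>

lemma distance_set_weights:
  fixes X :: "(real ^ 'n::finite) set"
  assumes fin: "finite X" and nodes: "normalized_nodes (Suc (Suc m)) a"
    and card: "(CARD('n) + Suc m choose Suc m) + (CARD('n) + m choose m) < card X"
    and dist: "\<And>x y. x \<in> X \<Longrightarrow> y \<in> X \<Longrightarrow> x \<noteq> y \<Longrightarrow> \<exists>i<Suc (Suc m). (dist x y / M)\<^sup>2 = a i"
  shows "\<exists>K. weights_at_zero (Suc (Suc m)) K a \<and>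
    K \<in> {..<Suc (Suc m)} \<rightarrow>\<^sub>E uminus ` binary_eigenvalues (card X)"
proof -
  define s where "s = Suc (Suc m)"
  define n where "n = card X"
  have inj: "inj_on a {..<s}" and pos: "\<And>i. i < s \<Longrightarrow> 0 < a i"
    using nodes by (auto simp: normalized_nodes_def s_def intro: strict_mono_on_imp_inj_on)
  obtain v z where z: "z \<in> X" "v z \<noteq> 0" and
    v0: "\<And>x p c. degree p \<le> Suc m \<Longrightarrow> (\<Sum>y\<in>X. v y * poly p (c * (dist x y)\<^sup>2)) = 0"
    using exists_distance_annihilator[OF fin card] by blast
  \<comment> \<open>The scaling factor c in the annihilator property absorbs the normalisation by
    M.\<close>
  have v: "(\<Sum>y\<in>X. v y * poly p ((dist x y / M)\<^sup>2)) = 0" if "degree p < s" for x p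
    using v0[of p "1 / M\<^sup>2" x] that by (simp add: s_def power_divide)
  define K where "K = restrict (\<lambda>i. poly (lagrange_basis s a i) 0) {..<s}"
  define B where "B i x y = (if x \<noteq> y \<and> (dist x y / M)\<^sup>2 = a i then 1 else 0 :: real)"
    for i and x y :: "real ^ 'n"
  \<comment> \<open>Every y other than x lies in exactly one distance class, so the sum is regrouped
    by classes; y = x contributes the value at 0.\<close>
  have split: "(\<Sum>y\<in>X. v y * poly p ((dist x y / M)\<^sup>2))
      = v x * poly p 0 + (\<Sum>i<s. poly p (a i) * (\<Sum>y\<in>X. B i x y * v y))" if x: "x \<in> X" for p x
  proof -
    have decomp: "v y * poly p ((dist x y / M)\<^sup>2) = (\<Sum>i<s. poly p (a i) * (B i x y * v y))"
      if y: "y \<in> X - {x}" for y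
    proof -
      obtain j where j: "j < s" "(dist x y / M)\<^sup>2 = a j" using dist[OF x, of y] y by (auto simp: s_def)
      have "(\<Sum>i<s. poly p (a i) * (B i x y * v y)) = (\<Sum>i<s. if i = j then poly p (a j) * v y else 0)"
        using j y inj by (intro sum.cong) (auto simp: B_def inj_on_def)
      then show ?thesis using j by simp
    qed
    have "(\<Sum>y\<in>X. v y * poly p ((dist x y / M)\<^sup>2))
        = v x * poly p 0 + (\<Sum>y\<in>X - {x}. v y * poly p ((dist x y / M)\<^sup>2))"
      using x fin by (simp add: sum.remove[of X x])
    also have "(\<Sum>y\<in>X - {x}. v y * poly p ((dist x y / M)\<^sup>2))
        = (\<Sum>y\<in>X - {x}. \<Sum>i<s. poly p (a i) * (B i x y * v y))"
      by (intro sum.cong refl decomp)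
    \<comment> \<open>\<open>B\<close> vanishes on the diagonal, so x may be put back.\<close>
    also have "\<dots> = (\<Sum>y\<in>X. \<Sum>i<s. poly p (a i) * (B i x y * v y))"
      using fin by (intro sum.mono_neutral_left) (auto simp: B_def)
    also have "\<dots> = (\<Sum>i<s. \<Sum>y\<in>X. poly p (a i) * (B i x y * v y))" by (rule sum.swap)
    also have "\<dots> = (\<Sum>i<s. poly p (a i) * (\<Sum>y\<in>X. B i x y * v y))" by (simp only: sum_distrib_left)
    finally show ?thesis .
  qed
  have eig: "(\<Sum>y\<in>X. B i x y * v y) = - K i * v x" if i: "i < s" and x: "x \<in> X" for i x
  proof -
    have "(\<Sum>j<s. poly (lagrange_basis s a i) (a j) * (\<Sum>y\<in>X. B j x y * v y))
        = (\<Sum>j<s. if j = i then (\<Sum>y\<in>X. B i x y * v y) else 0)"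
      using i inj by (intro sum.cong) (auto simp: poly_lagrange_basis)
    then have "v x * poly (lagrange_basis s a i) 0 + (\<Sum>y\<in>X. B i x y * v y) = 0"
      using split[OF x, of "lagrange_basis s a i"] v[OF degree_lagrange_basis[OF i], of a x] i by simp
    then show ?thesis using i by (simp add: K_def algebra_simps)
  qed
  have "weights_at_zero s K a"
    unfolding weights_at_zero_def
  proof (intro allI impI)
    fix p :: "real poly" assume deg: "degree p < s"
    have "0 = v z * poly p 0 + (\<Sum>i<s. poly p (a i) * (- K i * v z))"
      using split[OF z(1), of p] v[OF deg, of z] eig[OF _ z(1)] by simp
    also have "\<dots> = v z * (poly p 0 - (\<Sum>i<s. K i * poly p (a i)))"
      by (simp add: algebra_simps sum_distrib_left sum_negf)
    finally show "(\<Sum>i<s. K i * poly p (a i)) = poly p 0" using z(2) by simp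
  qed
  moreover have "K i \<in> uminus ` binary_eigenvalues n" if i: "i < s" for i
  proof -
    \<comment> \<open>Enumerating X turns \<open>B i\<close> into a matrix indexed by numbers, so
      the set of possible eigenvalues depends only on the size of X.\<close>
    obtain e where e: "bij_betw e {..<n} X"
      using ex_bij_betw_nat_finite[OF fin] by (auto simp: n_def atLeast0LessThan)
    define A where "A = restrict (\<lambda>(p, q). B i (e p) (e q)) ({..<n} \<times> {..<n})"
    have "A \<in> {..<n} \<times> {..<n} \<rightarrow>\<^sub>E {0, 1}"
      unfolding A_def by (rule restrict_PiE_iff[THEN iffD2]) (simp add: B_def split: prod.split)
    moreover have "\<forall>p<n. \<forall>q<n. A (p, q) = A (q, p)" by (auto simp: A_def B_def dist_commute)
    moreover have "\<exists>p<n. (v \<circ> e) p \<noteq> 0" using z e by (auto simp: bij_betw_def)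
    moreover have "(\<Sum>q<n. A (p, q) * (v \<circ> e) q) = - K i * (v \<circ> e) p" if p: "p < n" for p
    proof -
      have "(\<Sum>q<n. A (p, q) * (v \<circ> e) q) = (\<Sum>q<n. B i (e p) (e q) * v (e q))"
        using p by (simp add: A_def)
      also have "\<dots> = (\<Sum>y\<in>X. B i (e p) y * v y)"
        by (rule sum.reindex_bij_betw[OF e])
      also have "\<dots> = - K i * (v \<circ> e) p"
        using eig[OF i, of "e p"] e p by (auto simp: bij_betw_def)
      finally show ?thesis .
    qed
    ultimately have "- K i \<in> binary_eigenvalues n" unfolding binary_eigenvalues_def by blast
    then show ?thesis by force
  qed
  ultimately show ?thesis unfolding s_def[symmetric] n_def[symmetric]
    by (intro exI[of _ K] conjI PiE_I) (auto simp: K_def)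
qed

text \<open>The size of X is bounded, so the weights come from a finite set, each weight vector
  admits finitely many nodes, and every ratio is 0 or the square root of a node. The set R is
  uniform in X.\<close>

lemma finite_distance_ratios:
  fixes m :: nat
  shows "\<exists>R. finite R \<and> (\<forall>X :: (real ^ 'n::finite) set. s_distance_set (Suc (Suc m)) X \<longrightarrow>
    (CARD('n) + Suc m choose Suc m) + (CARD('n) + m choose m) < card X \<longrightarrow>
    (\<forall>x\<in>X. \<forall>y\<in>X. dist x y / Max (dist_set X) \<in> R))"
proof -
  define s where "s = Suc (Suc m)"
  define b where "b = (CARD('n) + s choose s) + (CARD('n) + (s - 1) choose (s - 1))"
  define E where "E = (\<Union>n\<le>b. uminus ` binary_eigenvalues n)"
  define S where "S = (\<Union>K\<in>{..<s} \<rightarrow>\<^sub>E E. {a. normalized_nodes s a \<and> weights_at_zero s K a})"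
  define R where "R = insert 0 (\<Union>a\<in>S. (\<lambda>i. sqrt (a i)) ` {..<s})"
  have "finite S" unfolding S_def E_def
    by (intro finite_UN_I finite_PiE finite_normalized_nodes finite_imageI finite_binary_eigenvalues)
      (auto simp: s_def)
  then have "finite R" by (simp add: R_def)
  moreover have "dist x y / Max (dist_set X) \<in> R"
    if X: "s_distance_set s X"
      and card: "(CARD('n) + Suc m choose Suc m) + (CARD('n) + m choose m) < card X"
      and xy: "x \<in> X" "y \<in> X" for X :: "(real ^ 'n) set" and x y
  proof -
    obtain a where a: "normalized_nodes s a" "Max (dist_set X) > 0"
      "\<And>x y. x \<in> X \<Longrightarrow> y \<in> X \<Longrightarrow> x \<noteq> y \<Longrightarrow> \<exists>i<s. (dist x y / Max (dist_set X))\<^sup>2 = a i"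
      using squared_distances_enumeration[OF X] by (auto simp: s_def)
    have "finite X" using X by (simp add: s_distance_set_def)
    then obtain K where K: "weights_at_zero s K a" "K \<in> {..<s} \<rightarrow>\<^sub>E uminus ` binary_eigenvalues (card X)"
      using distance_set_weights[OF _ a(1)[unfolded s_def] card a(3)[unfolded s_def]]
      unfolding s_def by blast
    have "card X \<le> b" unfolding b_def by (rule card_distance_set_le[OF X]) (simp add: s_def)
    then have "uminus ` binary_eigenvalues (card X) \<subseteq> E" by (auto simp: E_def)
    then have "K \<in> {..<s} \<rightarrow>\<^sub>E E" using K(2) PiE_mono[of "{..<s}" "\<lambda>_. uminus ` binary_eigenvalues (card X)" "\<lambda>_. E"] by blast
    then have "a \<in> S" using a(1) K(1) by (auto simp: S_def)
    show ?thesis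
    proof (cases "x = y")
      case False
      then obtain i where i: "i < s" "(dist x y / Max (dist_set X))\<^sup>2 = a i" using a(3) xy by blast
      have "dist x y / Max (dist_set X) = sqrt (a i)"
        using a(2) by (subst i(2)[symmetric]) simp
      then show ?thesis using \<open>a \<in> S\<close> i(1) by (auto simp: R_def)
    qed (simp add: R_def)
  qed
  ultimately show ?thesis unfolding s_def by blast
qed

section \<open>From distance ratios to similarity classes\<close>

text \<open>Scaling Y by M / M' makes corresponding distances equal; then
  \<open>isometry_extending_finite\<close> applies.\<close>

lemma similar_sets_if_same_ratios:
  fixes X Y :: "'a::real_inner set"
  assumes e: "bij_betw e {..<n::nat} X" and e': "bij_betw e' {..<n} Y"
    and pos: "0 < M" "0 < M'"
    and eq: "\<And>i j. i < n \<Longrightarrow> j < n \<Longrightarrow> dist (e i) (e j) / M = dist (e' i) (e' j) / M'"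
  shows "similar_sets X Y"
proof -
  let ?c = "M / M'"
  have "dist (?c *\<^sub>R e' i) (?c *\<^sub>R e' j) = dist (e i) (e j)" if "i < n" "j < n" for i j
  proof -
    have "dist (?c *\<^sub>R e' i) (?c *\<^sub>R e' j) = ?c * dist (e' i) (e' j)"
      using pos by (simp add: dist_norm flip: scaleR_diff_right)
    also have "\<dots> = dist (e i) (e j)" using eq[OF that] pos by (simp add: field_simps)
    finally show ?thesis .
  qed
  then obtain f where f: "\<forall>u v. dist (f u) (f v) = dist u v" "\<forall>i<n. f (?c *\<^sub>R e' i) = e i"
    using isometry_extending_finite[of n "\<lambda>i. ?c *\<^sub>R e' i" e] by blast
  let ?g = "\<lambda>u. f (?c *\<^sub>R u)"
  have "dist (?g u) (?g v) = ?c * dist u v" for u v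
    using f(1) pos by (simp add: dist_norm flip: scaleR_diff_right)
  then have "similarity_map ?g" unfolding similarity_map_def using pos by (intro exI[of _ ?c]) simp
  moreover have "?g ` Y = X"
  proof -
    have "?g ` Y = (\<lambda>i. ?g (e' i)) ` {..<n}" using e' by (auto simp: bij_betw_def)
    also have "\<dots> = e ` {..<n}" using f(2) by (intro image_cong) auto
    also have "\<dots> = X" using e by (simp add: bij_betw_def)
    finally show ?thesis .
  qed
  ultimately show ?thesis unfolding similar_sets_def by blast
qed

text \<open>\<open>inv_into\<close> selects one element of A for each of the finitely many values of
  the invariant.\<close>

lemma finite_representatives:
  assumes "finite (\<Phi> ` A)" and "\<And>x y. x \<in> A \<Longrightarrow> y \<in> A \<Longrightarrow> \<Phi> x = \<Phi> y \<Longrightarrow> R x y"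
  shows "\<exists>F. finite F \<and> (\<forall>x\<in>A. \<exists>y\<in>F. R x y)"
proof (intro exI conjI ballI)
  show "finite (inv_into A \<Phi> ` \<Phi> ` A)" using assms(1) by simp
  fix x assume "x \<in> A"
  then show "\<exists>y\<in>inv_into A \<Phi> ` \<Phi> ` A. R x y"
    by (intro bexI[of _ "inv_into A \<Phi> (\<Phi> x)"] assms(2))
      (auto simp: inv_into_into f_inv_into_f)
qed

theorem theorem4p4:
  fixes s :: nat
  assumes "s \<ge> 2"
  defines "d \<equiv> CARD('n::finite)"
  shows "\<exists>F :: (real ^ 'n) set set. finite F \<and>
           (\<forall>X :: (real ^ 'n) set. s_distance_set s X \<and>
               card X \<ge> 2 * ((d + s - 1) choose (s - 1)) + 2 * ((d + s - 2) choose (s - 2))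
             \<longrightarrow> (\<exists>Y\<in>F. similar_sets X Y))"
proof -
  obtain m where m: "s = Suc (Suc m)" using assms(1) by (metis add_2_eq_Suc le_Suc_ex)
  \<comment> \<open>Sets with more than N points, where N is half of the threshold in the
    theorem.\<close>
  define \<X> where "\<X> = {X :: (real ^ 'n) set. s_distance_set s X \<and>
    (CARD('n) + Suc m choose Suc m) + (CARD('n) + m choose m) < card X}"
  obtain R where R: "finite R" "\<And>X x y. X \<in> \<X> \<Longrightarrow> x \<in> X \<Longrightarrow> y \<in> X \<Longrightarrow> dist x y / Max (dist_set X) \<in> R"
    using finite_distance_ratios[where 'n = 'n, of m] unfolding m \<X>_def by blast
  define b where "b = (CARD('n) + s choose s) + (CARD('n) + (s - 1) choose (s - 1))"
  have "\<exists>e. bij_betw e {..<card X} X" if "X \<in> \<X>" for X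
    using ex_bij_betw_nat_finite[of X] that by (auto simp: \<X>_def s_distance_set_def atLeast0LessThan)
  then obtain e where e: "\<And>X. X \<in> \<X> \<Longrightarrow> bij_betw (e X) {..<card X} X" by metis
  \<comment> \<open>The size and the normalised distance matrix in a chosen enumeration. Similar
    sets may get different values; this only adds representatives.\<close>
  define \<Phi> where "\<Phi> X = (card X, restrict (\<lambda>(i, j). dist (e X i) (e X j) / Max (dist_set X))
    ({..<card X} \<times> {..<card X}))" for X
  have "\<Phi> X \<in> (SIGMA n:{..b}. {..<n} \<times> {..<n} \<rightarrow>\<^sub>E R)" if "X \<in> \<X>" for X
  proof -
    have "card X \<le> b" unfolding b_def
      using that by (intro card_distance_set_le) (auto simp: \<X>_def m)
    moreover have "e X i \<in> X" if "i < card X" for i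
      using e[OF \<open>X \<in> \<X>\<close>] that by (auto simp: bij_betw_def)
    ultimately show ?thesis using R(2)[OF that]
      unfolding \<Phi>_def by (intro SigmaI restrict_PiE_iff[THEN iffD2]) (simp_all split: prod.split)
  qed
  then have "\<Phi> ` \<X> \<subseteq> (SIGMA n:{..b}. {..<n} \<times> {..<n} \<rightarrow>\<^sub>E R)" by (rule image_subsetI)
  moreover have "finite (SIGMA n:{..b}. {..<n} \<times> {..<n} \<rightarrow>\<^sub>E R)"
    by (intro finite_SigmaI finite_PiE finite_atMost finite_cartesian_product finite_lessThan R(1))
  ultimately have "finite (\<Phi> ` \<X>)" by (rule finite_subset)
  moreover have "similar_sets X Y" if XY: "X \<in> \<X>" "Y \<in> \<X>" "\<Phi> X = \<Phi> Y" for X Y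
  proof (rule similar_sets_if_same_ratios)
    have n: "card Y = card X" using XY(3) by (simp add: \<Phi>_def)
    show "bij_betw (e X) {..<card X} X" "bij_betw (e Y) {..<card X} Y"
      using e[OF XY(1)] e[OF XY(2)] n by simp_all
    show "0 < Max (dist_set X)" "0 < Max (dist_set Y)"
      using squared_distances_enumeration[of s] XY(1,2) assms(1) by (auto simp: \<X>_def)
    fix i j assume "i < card X" "j < card X"
    then show "dist (e X i) (e X j) / Max (dist_set X) = dist (e Y i) (e Y j) / Max (dist_set Y)"
      using fun_cong[OF conjunct2[OF XY(3)[unfolded \<Phi>_def prod.inject]], of "(i, j)"] n by simp
  qed
  ultimately obtain F where F: "finite F" "\<forall>X\<in>\<X>. \<exists>Y\<in>F. similar_sets X Y"
    using finite_representatives[of \<Phi> \<X> similar_sets] by blast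
  moreover have "X \<in> \<X>" if "s_distance_set s X"
    "card X \<ge> 2 * ((d + s - 1) choose (s - 1)) + 2 * ((d + s - 2) choose (s - 2))" for X :: "(real ^ 'n) set"
  proof -
    \<comment> \<open>Positivity turns 2N <= \<open>card X\<close> into N <
      \<open>card X\<close>.\<close>
    have "0 < (CARD('n) + Suc m choose Suc m)" by (rule zero_less_binomial) simp
    moreover have "2 * (CARD('n) + Suc m choose Suc m) + 2 * (CARD('n) + m choose m) \<le> card X"
      using that(2) by (simp add: d_def m del: binomial_Suc_Suc)
    ultimately show ?thesis using that(1) unfolding \<X>_def by (intro CollectI conjI) linarith+
  qed
  ultimately show ?thesis by blast
qed

end
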